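(* For any integer $n>1$, the algebraic connectivity $\lambda_{n-1}(\mathcal{G}(\mathbb{Z}_n))$ of the power graph of $\mathbb{Z}_n$ equals $\phi(n)+1$ if and only if $n$ is a prime number or a product of two distinct primes.
   Context: $\mathbb{Z}_n$ is the additive cyclic group of order $n$; $\phi$ is Euler's phi function. The power graph $\mathcal{G}(G)$ of a group $G$ has vertex set $G$, distinct $u,v$ adjacent iff one is a positive power of the other. For a graph $\Gamma$ on $n$ vertices, $\lambda_1(\Gamma)\ge\cdots\ge\lambda_n(\Gamma)=0$ are the eigenvalues of the Laplacian matrix $L(\Gamma)=D(\Gamma)-A(\Gamma)$, and $\lambda_{n-1}(\Gamma)$ is the algebraic connectivity. *)

theory Defs
  imports
    "Jordan_Normal_Form.Char_Poly"
    "Graph_Theory.Pair_Digraph"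
    "HOL-Algebra.Elementary_Groups"
    "HOL-Number_Theory.Totient"
begin

text \<open>
  A simple graph is a symmetric, loop-free \<open>pair_pre_digraph\<close> (locale \<open>pair_graph\<close>): each edge
  is stored as its two arcs, so the degree of a vertex is its out-degree.
\<close>

definition power_graph :: "('a, 'b) monoid_scheme \<Rightarrow> 'a pair_pre_digraph" where
  "power_graph G = \<lparr> pverts = carrier G,
     parcs = {(u, v). u \<in> carrier G \<and> v \<in> carrier G \<and> u \<noteq> v \<and>
       ((\<exists>k::nat. k > 0 \<and> v = u [^]\<^bsub>G\<^esub> k) \<or> (\<exists>k::nat. k > 0 \<and> u = v [^]\<^bsub>G\<^esub> k))} \<rparr>"

lemma pair_graph_power_graph:
  assumes "finite (carrier G)"
  shows "pair_graph (power_graph G)"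
proof -
  have "parcs (power_graph G) \<subseteq> carrier G \<times> carrier G"
    by (auto simp: power_graph_def)
  hence "finite (parcs (power_graph G))"
    using assms finite_subset by blast
  moreover have "sym (parcs (power_graph G))"
    by (auto simp: power_graph_def sym_def)
  ultimately show ?thesis
    using assms
    by unfold_locales (auto simp: power_graph_def symmetric_def arcs_ends_def arc_to_ends_def)
qed

text \<open>
  The matrices below list the vertices in increasing order. Another enumeration of the vertices
  conjugates the Laplacian by a permutation matrix and leaves its eigenvalues unchanged.
\<close>

definition vertex_list :: "('a::linorder) pair_pre_digraph \<Rightarrow> 'a list" where
  "vertex_list \<Gamma> = sorted_list_of_set (pverts \<Gamma>)"

definition adjacency_matrix :: "('a::linorder) pair_pre_digraph \<Rightarrow> real mat" where
  "adjacency_matrix \<Gamma> = mat (card (pverts \<Gamma>)) (card (pverts \<Gamma>))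
     (\<lambda>(i, j). if (vertex_list \<Gamma> ! i, vertex_list \<Gamma> ! j) \<in> parcs \<Gamma> then 1 else 0)"

definition degree_matrix :: "('a::linorder) pair_pre_digraph \<Rightarrow> real mat" where
  "degree_matrix \<Gamma> = mat (card (pverts \<Gamma>)) (card (pverts \<Gamma>))
     (\<lambda>(i, j). if i = j then real (out_degree (with_proj \<Gamma>) (vertex_list \<Gamma> ! i)) else 0)"

definition laplacian_matrix :: "('a::linorder) pair_pre_digraph \<Rightarrow> real mat" where
  "laplacian_matrix \<Gamma> = degree_matrix \<Gamma> - adjacency_matrix \<Gamma>"

text \<open>
  The eigenvalues with multiplicity, in decreasing order. For a simple graph the Laplacian is real
  symmetric, so its characteristic polynomial splits over the reals and the list has one entry per
  vertex.
\<close>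

definition laplacian_eigenvalues :: "('a::linorder) pair_pre_digraph \<Rightarrow> real list" where
  "laplacian_eigenvalues \<Gamma> =
     rev (sorted_list_of_multiset (proots (char_poly (laplacian_matrix \<Gamma>))))"

text \<open>Indexed from 1, so that \<open>laplacian_eigenvalue \<Gamma> 1\<close> is the largest.\<close>

definition laplacian_eigenvalue :: "('a::linorder) pair_pre_digraph \<Rightarrow> nat \<Rightarrow> real" where
  "laplacian_eigenvalue \<Gamma> i = laplacian_eigenvalues \<Gamma> ! (i - 1)"

text \<open>Only meaningful for graphs with at least two vertices.\<close>

definition algebraic_connectivity :: "('a::linorder) pair_pre_digraph \<Rightarrow> real" where
  "algebraic_connectivity \<Gamma> = laplacian_eigenvalue \<Gamma> (card (pverts \<Gamma>) - 1)"

end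

theory Submission
  imports Defs "Jordan_Normal_Form.Schur_Decomposition"
begin

text \<open>
  The generators of \<open>\<int>\<^sub>n\<close> together with \<open>0\<close> form a set \<open>S\<close> of \<open>\<phi>(n) + 1\<close> vertices adjacent to all others. An
  eigenfunction \<open>f\<close> of the Laplacian for an eigenvalue \<open>\<mu> \<noteq> 0\<close> sums to \<open>0\<close>, so \<open>n f(s) = \<mu> f(s)\<close> on \<open>S\<close>.
  Hence either \<open>\<mu> = n\<close>, or \<open>f\<close> vanishes on \<open>S\<close> and is an eigenfunction of the graph induced on the
  complement of \<open>S\<close> for the eigenvalue \<open>\<mu> - |S| \<ge> 0\<close>. As \<open>0\<close> is a simple eigenvalue, the algebraic
  connectivity is \<open>|S|\<close> iff \<open>|S|\<close> is an eigenvalue, which for \<open>S \<noteq> \<int>\<^sub>n\<close> means that the induced graph is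
  disconnected. There every vertex is adjacent or equal to a prime divisor \<open>p\<close> of \<open>n\<close>, and two prime
  divisors \<open>p\<close>, \<open>q\<close> are joined through \<open>p q\<close> unless \<open>n = p q\<close>.
\<close>

section \<open>Linear algebra\<close>

text \<open>The characteristic polynomial splits over the complex numbers. When all its roots are
  real, that factorization is the image of a real one under the injective embedding of real
  polynomials.\<close>

lemma char_poly_splits_real:
  fixes A :: "real mat"
  assumes A: "A \<in> carrier_mat n n"
    and real: "\<And>\<mu> :: complex. eigenvalue (map_mat of_real A) \<mu> \<Longrightarrow> \<mu> \<in> \<real>"
  obtains es where "char_poly A = (\<Prod>e\<leftarrow>es. [:-e, 1:])" "length es = n"
proof -
  let ?C = "map_mat of_real A :: complex mat"
  have C: "?C \<in> carrier_mat n n" using A by simp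
  obtain zs where zs: "char_poly ?C = (\<Prod>z\<leftarrow>zs. [:-z, 1:])" "length zs = n"
    using char_poly_factorized[OF C] by blast
  interpret map_poly_cr: map_poly_inj_idom_hom complex_of_real ..
  have "z \<in> \<real>" if "z \<in> set zs" for z
  proof (rule real)
    have "poly (char_poly ?C) z = 0"
      unfolding zs(1) using that by (auto simp: poly_prod_list prod_list_zero_iff)
    thus "eigenvalue ?C z" using eigenvalue_root_char_poly[OF C] by blast
  qed
  hence "(\<Prod>z\<leftarrow>zs. [:-z, 1:]) = map_poly of_real (\<Prod>e\<leftarrow>map Re zs. [:-e, 1:])"
    by (induction zs) (auto simp: of_real_hom.map_poly_pCons_hom map_poly_cr.hom_mult simp del: mult_pCons_left)
  moreover have "char_poly ?C = map_poly of_real (char_poly A)"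
    by (rule of_real_hom.char_poly_hom[OF A])
  ultimately have "map_poly complex_of_real (char_poly A) = map_poly of_real (\<Prod>e\<leftarrow>map Re zs. [:-e, 1:])"
    using zs(1) by simp
  hence "char_poly A = (\<Prod>e\<leftarrow>map Re zs. [:-e, 1:])"
    by simp
  thus thesis using that[of "map Re zs"] zs(2) by simp
qed

text \<open>
  In a Schur form listing \<open>a\<close> twice at the front, the first two basis vectors \<open>x\<close>, \<open>y\<close> span an invariant
  plane.
\<close>
lemma repeated_eigenvalue_generalized_eigenvector:
  fixes A :: "'a :: conjugatable_ordered_field mat"
  assumes A: "A \<in> carrier_mat n n"
    and cp: "char_poly A = (\<Prod>e\<leftarrow>a # a # es. [:-e, 1:])"
  obtains x y b where "x \<in> carrier_vec n" "y \<in> carrier_vec n" "x \<noteq> 0\<^sub>v n" "\<And>c. y \<noteq> c \<cdot>\<^sub>v x"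
    "A *\<^sub>v x = a \<cdot>\<^sub>v x" "A *\<^sub>v y = a \<cdot>\<^sub>v y + b \<cdot>\<^sub>v x"
proof -
  obtain B P Q where "schur_decomposition A (a # a # es) = (B, P, Q)"
    by (cases "schur_decomposition A (a # a # es)") auto
  from schur_decomposition[OF A cp this]
  have sim: "similar_mat_wit A B P Q" and ut: "upper_triangular B" and diag: "diag_mat B = a # a # es"
    by blast+
  from similar_mat_witD2[OF A sim] have carr: "B \<in> carrier_mat n n" "P \<in> carrier_mat n n" "Q \<in> carrier_mat n n"
    and QP: "Q * P = 1\<^sub>m n" and A_eq: "A = P * B * Q" by blast+
  have "length (diag_mat B) = n" using carr by (simp add: diag_mat_def)
  hence n: "n \<ge> 2" using diag by simp
  have B00: "B $$ (0, 0) = a" and B11: "B $$ (1, 1) = a"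
    using arg_cong[OF diag, of "\<lambda>l. l ! 0"] arg_cong[OF diag, of "\<lambda>l. l ! 1"] n carr
    by (auto simp: diag_mat_def)
  let ?x = "P *\<^sub>v unit_vec n 0" and ?y = "P *\<^sub>v unit_vec n 1" and ?b = "B $$ (0, 1)"
  have Bx: "B *\<^sub>v unit_vec n 0 = a \<cdot>\<^sub>v unit_vec n 0"
    using carr n B00 ut
    by (intro eq_vecI) (auto simp: upper_triangular_def)
  have By: "B *\<^sub>v unit_vec n 1 = a \<cdot>\<^sub>v unit_vec n 1 + ?b \<cdot>\<^sub>v unit_vec n 0"
  proof (rule eq_vecI)
    fix i assume "i < dim_vec (a \<cdot>\<^sub>v unit_vec n 1 + ?b \<cdot>\<^sub>v unit_vec n 0)"
    hence "i < n" by simp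
    moreover consider "i = 0" | "i = 1" | "i > 1" by linarith
    ultimately show "(B *\<^sub>v unit_vec n 1) $ i = (a \<cdot>\<^sub>v unit_vec n 1 + ?b \<cdot>\<^sub>v unit_vec n 0) $ i"
      using carr n B11 ut by cases (auto simp: upper_triangular_def)
  qed (use carr in auto)
  \<comment> \<open>\<open>P\<close> intertwines \<open>B\<close> and \<open>A\<close>, so the
    relations \<open>Bx\<close> and \<open>By\<close> for unit vectors carry over to
    \<open>?x\<close> and \<open>?y\<close>.\<close>
  have AP: "A *\<^sub>v (P *\<^sub>v v) = P *\<^sub>v (B *\<^sub>v v)" if v: "v \<in> carrier_vec n" for v
  proof -
    have "A *\<^sub>v (P *\<^sub>v v) = (P * B) *\<^sub>v (Q *\<^sub>v (P *\<^sub>v v))"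
      unfolding A_eq using carr v by (intro assoc_mult_mat_vec) auto
    also have "Q *\<^sub>v (P *\<^sub>v v) = (Q * P) *\<^sub>v v"
      using carr v by (intro assoc_mult_mat_vec[symmetric]) auto
    also have "\<dots> = v" using QP v by simp
    finally show ?thesis using carr v by (simp add: assoc_mult_mat_vec[of _ n n _ n])
  qed
  \<comment> \<open>\<open>Q\<close> undoes \<open>P\<close>: a linear dependence between
    \<open>?x\<close> and \<open>?y\<close> would pull back to the unit vectors.\<close>
  have QPv: "Q *\<^sub>v (P *\<^sub>v v) = v" if v: "v \<in> carrier_vec n" for v
    using assoc_mult_mat_vec[OF carr(3,2) v] QP v by simp
  show thesis
  proof (rule that)
    show "?x \<in> carrier_vec n" "?y \<in> carrier_vec n" using carr by auto
    show "?x \<noteq> 0\<^sub>v n"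
    proof
      have zero_vec: "Q *\<^sub>v 0\<^sub>v n = 0\<^sub>v n" using carr by (intro eq_vecI) auto
      assume "?x = 0\<^sub>v n"
      hence "unit_vec n 0 = (0\<^sub>v n :: 'a vec)" using QPv[of "unit_vec n 0"] zero_vec by simp
      thus False using n by (auto dest: arg_cong[of _ _ "\<lambda>v. v $ 0"])
    qed
    show "?y \<noteq> c \<cdot>\<^sub>v ?x" for c
    proof
      assume "?y = c \<cdot>\<^sub>v ?x"
      hence "Q *\<^sub>v ?y = c \<cdot>\<^sub>v (Q *\<^sub>v ?x)"
        using carr by (simp add: mult_mat_vec[of _ n n])
      hence "unit_vec n 1 = c \<cdot>\<^sub>v (unit_vec n 0 :: 'a vec)" by (simp add: QPv)
      from arg_cong[OF this, of "\<lambda>v. v $ 1"] show False using n by auto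
    qed
    show "A *\<^sub>v ?x = a \<cdot>\<^sub>v ?x"
      using carr by (simp add: AP Bx mult_mat_vec[of _ n n])
    show "A *\<^sub>v ?y = a \<cdot>\<^sub>v ?y + ?b \<cdot>\<^sub>v ?x"
      using carr by (simp add: AP By mult_mat_vec[of _ n n] mult_add_distrib_mat_vec[of _ n n] del: One_nat_def)
  qed
qed

text \<open>Since 0 occurs exactly once and all other elements are at least \<open>m > 0\<close>,
  the increasing list is 0 followed by the rest, whose minimum is \<open>m\<close> precisely when
  \<open>m\<close> occurs.\<close>

lemma second_smallest_eq_iff:
  fixes M :: "real multiset"
  assumes "0 \<in># M" "\<not> {#0, 0#} \<subseteq># M" "m > 0" "size M \<ge> 2"
    and ge: "\<And>x. x \<in># M \<Longrightarrow> x \<noteq> 0 \<Longrightarrow> m \<le> x"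
  shows "rev (sorted_list_of_multiset M) ! (size M - 2) = m \<longleftrightarrow> m \<in># M"
proof -
  obtain M' where M: "M = add_mset 0 M'" using assms(1) by (metis mset_add)
  have "0 \<notin># M'" using assms(2) unfolding M by simp
  hence ge': "m \<le> x" if "x \<in># M'" for x using ge[of x] that M by auto
  have "sorted_list_of_multiset M = 0 # sorted_list_of_multiset M'"
  proof -
    have "sorted (0 # sorted_list_of_multiset M')"
      using ge' \<open>m > 0\<close> by force
    hence "sort (0 # sorted_list_of_multiset M') = 0 # sorted_list_of_multiset M'" by (rule sorted_sort_id)
    moreover have "sorted_list_of_multiset M = sort (0 # sorted_list_of_multiset M')"
      by (simp only: sorted_list_of_multiset_mset[symmetric] mset.simps mset_sorted_list_of_multiset M)
    ultimately show ?thesis by simp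
  qed
  moreover have "size M' > 0" using assms(4) M by simp
  moreover obtain y ys where ys: "sorted_list_of_multiset M' = y # ys"
    using \<open>size M' > 0\<close> by (cases "sorted_list_of_multiset M'") (auto dest: arg_cong[of _ _ mset])
  moreover have len: "size M' = Suc (length ys)"
    using arg_cong[OF ys, of "size \<circ> mset"] by simp
  \<comment> \<open>Position \<open>size M - 2\<close> of the decreasing list is position 1 of the
    increasing one.\<close>
  ultimately have "rev (sorted_list_of_multiset M) ! (size M - 2) = y"
    by (simp add: M nth_append)
  moreover have mem: "set (y # ys) = set_mset M'" using ys by (metis set_sorted_list_of_multiset)
  moreover have "sorted (y # ys)" using ys by (metis sorted_sorted_list_of_multiset)
  moreover have "m \<in># M \<longleftrightarrow> m \<in># M'" using \<open>m > 0\<close> M by simp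
  ultimately show ?thesis using ge' by (metis list.set_intros(1) nle_le set_ConsD sorted_simps(2))
qed

section \<open>The Laplacian on vertex functions\<close>

text \<open>Acting on vertex functions avoids any enumeration of the vertices. The codomain is kept
  general because both real and complex eigenfunctions occur.\<close>

definition lap :: "('a \<times> 'a) set \<Rightarrow> ('a \<Rightarrow> 'b :: comm_ring_1) \<Rightarrow> 'a \<Rightarrow> 'b" where
  "lap E f u = (\<Sum>v\<in>E `` {u}. f u - f v)"

lemma finite_Image_subset:
  assumes "finite V" "E \<subseteq> V \<times> V"
  shows "finite (E `` X)"
  using assms by (auto intro: finite_subset[of _ V])

text \<open>Summation by parts: reversing all arcs of the symmetric \<open>E\<close> gives a second
  expression for the same sum, and adding the two produces the factor 2.\<close>

lemma green_formula:
  assumes V: "finite V" "E \<subseteq> V \<times> V" and E: "sym E"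
  shows "2 * (\<Sum>u\<in>V. h u * lap E f u) = (\<Sum>(u, v)\<in>E. (h u - h v) * (f u - f v))"
proof -
  have "(\<Sum>u\<in>V. h u * lap E f u) = (\<Sum>(u, v)\<in>Sigma V (\<lambda>u. E `` {u}). h u * (f u - f v))"
    using V by (subst sum.Sigma[symmetric]) (auto simp: lap_def sum_distrib_left finite_Image_subset)
  also have "Sigma V (\<lambda>u. E `` {u}) = E" using V(2) by auto
  finally have 1: "(\<Sum>u\<in>V. h u * lap E f u) = (\<Sum>(u, v)\<in>E. h u * (f u - f v))" .
  also have "\<dots> = (\<Sum>(u, v)\<in>E. h v * (f v - f u))"
    by (rule sum.reindex_bij_witness[of _ prod.swap prod.swap]) (use E in \<open>auto dest: symD\<close>)
  finally have "2 * (\<Sum>u\<in>V. h u * lap E f u)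
      = (\<Sum>(u, v)\<in>E. h u * (f u - f v)) + (\<Sum>(u, v)\<in>E. h v * (f v - f u))"
    using 1 by simp
  also have "\<dots> = (\<Sum>(u, v)\<in>E. (h u - h v) * (f u - f v))"
    by (simp add: sum.distrib[symmetric] case_prod_unfold algebra_simps)
  finally show ?thesis .
qed

lemma sum_lap_eq_0:
  fixes f :: "'a \<Rightarrow> real"
  assumes "finite V" "E \<subseteq> V \<times> V" "sym E"
  shows "(\<Sum>u\<in>V. lap E f u) = 0"
  using green_formula[OF assms, of "\<lambda>_. 1" f] by simp

text \<open>Green's formula with \<open>h\<close> the conjugate of \<open>f\<close> expresses
  \<open>\<mu>\<close> as a quotient of sums of squared moduli. This supplies the reality hypothesis
  of \<open>char_poly_splits_real\<close>.\<close>

lemma lap_eigenvalue_real: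
  fixes f :: "'a \<Rightarrow> complex"
  assumes V: "finite V" "E \<subseteq> V \<times> V" and E: "sym E"
    and eig: "\<And>u. u \<in> V \<Longrightarrow> lap E f u = \<mu> * f u" and "u \<in> V" "f u \<noteq> 0"
  shows "\<mu> \<in> \<real>"
proof -
  define t where "t = (\<Sum>u\<in>V. (cmod (f u))\<^sup>2)"
  have "t > 0" unfolding t_def using assms by (intro sum_pos2[of _ u]) auto
  have "2 * (\<Sum>u\<in>V. cnj (f u) * lap E f u) = (\<Sum>(u, v)\<in>E. cnj (f u - f v) * (f u - f v))"
    using green_formula[OF V E, of "\<lambda>u. cnj (f u)" f] by simp
  also have "\<dots> = of_real (\<Sum>(u, v)\<in>E. (cmod (f u - f v))\<^sup>2)"
    unfolding of_real_sum by (intro sum.cong) (auto simp: mult.commute[of "cnj _"] complex_norm_square[symmetric] simp del: complex_cnj_diff of_real_power)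
  also have "2 * (\<Sum>u\<in>V. cnj (f u) * lap E f u) = 2 * (\<Sum>u\<in>V. \<mu> * of_real ((cmod (f u))\<^sup>2))"
    using eig by (simp add: complex_norm_square mult_ac del: of_real_power)
  also have "\<dots> = of_real (2 * t) * \<mu>" by (simp add: t_def sum_distrib_left[symmetric])
  finally have "\<mu> = of_real ((\<Sum>(u, v)\<in>E. (cmod (f u - f v))\<^sup>2) / (2 * t))"
    using \<open>t > 0\<close> by (simp add: field_simps)
  thus ?thesis by (metis Reals_of_real)
qed

text \<open>With \<open>h = f\<close>, Green's formula equates \<open>\<mu>\<close> times a positive
  number with a sum of squares over the arcs. If \<open>\<mu> = 0\<close>, every square
  vanishes.\<close>

lemma lap_eigenvalue_nonneg:
  fixes f :: "'a \<Rightarrow> real"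
  assumes V: "finite V" "E \<subseteq> V \<times> V" and E: "sym E"
    and eig: "\<And>u. u \<in> V \<Longrightarrow> lap E f u = \<mu> * f u" and "u \<in> V" "f u \<noteq> 0"
  shows "\<mu> \<ge> 0" and "\<mu> = 0 \<Longrightarrow> (v, w) \<in> E \<Longrightarrow> f v = f w"
proof -
  have fin: "finite E" using V by (meson finite_SigmaI finite_subset)
  have "(\<Sum>u\<in>V. (f u)\<^sup>2) > 0" using assms by (intro sum_pos2[of _ u]) auto
  moreover have *: "2 * \<mu> * (\<Sum>u\<in>V. (f u)\<^sup>2) = (\<Sum>(u, v)\<in>E. (f u - f v)\<^sup>2)"
    using green_formula[OF V E, of f f] eig by (simp add: power2_eq_square sum_distrib_left mult_ac)
  moreover have "(\<Sum>(u, v)\<in>E. (f u - f v)\<^sup>2) \<ge> 0" by (intro sum_nonneg) auto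
  ultimately show "\<mu> \<ge> 0" by (metis not_le mult_neg_pos mult_less_0_iff zero_less_numeral)
  assume "\<mu> = 0" "(v, w) \<in> E"
  hence "(\<Sum>(u, v)\<in>E. (f u - f v)\<^sup>2) = 0" using * by simp
  hence "\<forall>p\<in>E. (case p of (u, v) \<Rightarrow> (f u - f v)\<^sup>2) = 0"
    using fin by (subst (asm) sum_nonneg_eq_0_iff) auto
  thus "f v = f w" using \<open>(v, w) \<in> E\<close> by auto
qed

section \<open>Graphs with a nonempty set of vertices adjacent to all others\<close>

locale dominated_graph =
  fixes V S :: "'a set" and E :: "('a \<times> 'a) set"
  assumes finite_V: "finite V" and E_subset: "E \<subseteq> V \<times> V" and sym_E: "sym E" and irrefl_E: "irrefl E"
    and S_subset: "S \<subseteq> V" and S_nonempty: "S \<noteq> {}"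
    and dominating: "\<And>s v. s \<in> S \<Longrightarrow> v \<in> V \<Longrightarrow> s \<noteq> v \<Longrightarrow> (s, v) \<in> E"
begin

lemma finite_S: "finite S"
  using S_subset finite_V finite_subset by blast

text \<open>The neighbours of \<open>s\<close> are all other vertices, and the missing term
  \<open>v = s\<close> is 0.\<close>

lemma lap_dominating:
  assumes "s \<in> S"
  shows "lap E f s = of_nat (card V) * f s - (\<Sum>v\<in>V. f v)"
proof -
  have "s \<in> V" using assms S_subset by blast
  have "E `` {s} = V - {s}"
    using assms dominating E_subset irrefl_E by (auto simp: irrefl_def)
  hence "lap E f s = (\<Sum>v\<in>V - {s}. f s - f v)" by (simp add: lap_def)
  also have "\<dots> = (\<Sum>v\<in>V. f s - f v)"
    using finite_V \<open>s \<in> V\<close> by (simp add: sum.remove)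
  finally show ?thesis by (simp add: sum_subtractf)
qed

text \<open>Every vertex of \<open>S\<close> is a neighbour of \<open>u\<close> and contributes
  \<open>f u - 0\<close>; the remaining neighbours are those in the induced graph.\<close>

lemma lap_not_dominating:
  assumes "u \<in> V - S" "\<And>s. s \<in> S \<Longrightarrow> f s = 0"
  shows "lap E f u = of_nat (card S) * f u + lap (Restr E (V - S)) f u"
proof -
  have "E `` {u} = S \<union> Restr E (V - S) `` {u}"
    using assms E_subset S_subset dominating[of _ u, THEN symD[OF sym_E]] by auto
  moreover have "finite (Restr E (V - S) `` {u})"
    using finite_V by (auto intro: finite_subset[of _ V])
  ultimately have "lap E f u = (\<Sum>v\<in>S. f u - f v) + (\<Sum>v\<in>Restr E (V - S) `` {u}. f u - f v)"
    using finite_S unfolding lap_def by (simp only:) (rule sum.union_disjoint, auto)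
  thus ?thesis using assms(2) by (simp add: lap_def)
qed

text \<open>A nonzero \<open>f\<close> in the kernel is constant along edges, and some
  \<open>s\<close> in \<open>S\<close> is joined to every other vertex.\<close>

lemma lap_kernel_constant:
  fixes f :: "'a \<Rightarrow> real"
  assumes "\<And>u. u \<in> V \<Longrightarrow> lap E f u = 0"
  shows "\<exists>c. \<forall>v\<in>V. f v = c"
proof (cases "\<exists>u\<in>V. f u \<noteq> 0")
  case True
  then obtain u where u: "u \<in> V" "f u \<noteq> 0" by blast
  have "f v = f w" if "(v, w) \<in> E" for v w
    using lap_eigenvalue_nonneg(2)[of V E f 0, OF finite_V E_subset sym_E _ u refl that] assms by simp
  moreover obtain s where "s \<in> S" using S_nonempty by blast
  ultimately show ?thesis using dominating[of s] by metis
qed auto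

lemma lap_eigenfunction_sum_zero:
  fixes f :: "'a \<Rightarrow> real"
  assumes "\<And>u. u \<in> V \<Longrightarrow> lap E f u = \<mu> * f u" "\<mu> \<noteq> 0"
  shows "(\<Sum>v\<in>V. f v) = 0"
  using sum_lap_eq_0[OF finite_V E_subset sym_E, of f] assms by (simp add: sum_distrib_left[symmetric])

lemma lap_eigenfunction_cases:
  fixes f :: "'a \<Rightarrow> real"
  assumes eig: "\<And>u. u \<in> V \<Longrightarrow> lap E f u = \<mu> * f u" and "\<mu> \<noteq> 0"
  obtains "\<mu> = card V" | "\<And>s. s \<in> S \<Longrightarrow> f s = 0"
    "\<And>u. u \<in> V - S \<Longrightarrow> lap (Restr E (V - S)) f u = (\<mu> - card S) * f u"
proof (cases "\<mu> = card V")
  case False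
  have 0: "f s = 0" if "s \<in> S" for s
    using lap_dominating[OF that, of f] eig[of s] lap_eigenfunction_sum_zero[OF assms] that S_subset False by auto
  moreover have "lap (Restr E (V - S)) f u = (\<mu> - card S) * f u" if "u \<in> V - S" for u
    using lap_not_dominating[OF that, of f] eig[of u] 0 that by (auto simp: algebra_simps)
  ultimately show thesis using that(2) by blast
qed

lemma induced_subgraph: "finite (V - S)" "Restr E (V - S) \<subseteq> (V - S) \<times> (V - S)" "sym (Restr E (V - S))"
  using finite_V sym_E by (auto simp: sym_def)

text \<open>Either \<open>\<mu> = card V\<close>, which is at least \<open>card S\<close>, or
  \<open>\<mu> - card S\<close> is a Laplacian eigenvalue of the induced graph and hence
  nonnegative.\<close>

lemma lap_eigenvalue_ge:
  fixes f :: "'a \<Rightarrow> real"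
  assumes eig: "\<And>u. u \<in> V \<Longrightarrow> lap E f u = \<mu> * f u" and "\<mu> \<noteq> 0" and u: "u \<in> V" "f u \<noteq> 0"
  shows "\<mu> \<ge> card S"
proof (rule lap_eigenfunction_cases[of f \<mu>, OF eig \<open>\<mu> \<noteq> 0\<close>])
  assume "\<mu> = card V"
  thus ?thesis using card_mono[OF finite_V S_subset] by simp
next
  assume f: "\<And>s. s \<in> S \<Longrightarrow> f s = 0"
    "\<And>u. u \<in> V - S \<Longrightarrow> lap (Restr E (V - S)) f u = (\<mu> - card S) * f u"
  have "u \<in> V - S" using f(1) u by auto
  thus ?thesis using lap_eigenvalue_nonneg(1)[OF induced_subgraph f(2) _ u(2)] by simp
qed

text \<open>A function \<open>g\<close> that is constant along edges but not constant expresses that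
  the graph induced on \<open>V - S\<close> is disconnected. Such functions yield eigenfunctions
  after subtraction of the mean.\<close>

lemma lap_eigenvalue_card_dominating_iff:
  assumes "S \<noteq> V"
  shows "(\<exists>f. (\<exists>u\<in>V. f u \<noteq> 0) \<and> (\<forall>u\<in>V. lap E f u = real (card S) * f u)) \<longleftrightarrow>
    (\<exists>g :: 'a \<Rightarrow> real. (\<exists>u\<in>V-S. \<exists>v\<in>V-S. g u \<noteq> g v) \<and> (\<forall>(u, v)\<in>Restr E (V - S). g u = g v))"
    (is "?L \<longleftrightarrow> ?R")
proof
  assume ?L
  then obtain f u where u: "u \<in> V" "f u \<noteq> 0" and eig: "\<And>u. u \<in> V \<Longrightarrow> lap E f u = real (card S) * f u"
    by blast
  \<comment> \<open>The strict inequality excludes the case \<open>\<mu> = card V\<close> of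
    \<open>lap_eigenfunction_cases\<close>.\<close>
  have "card S < card V" using assms S_subset finite_V by (intro psubset_card_mono) auto
  have "card S > 0" using finite_S S_nonempty by (simp add: card_gt_0_iff)
  hence c: "real (card S) \<noteq> 0" by simp
  have f: "\<And>s. s \<in> S \<Longrightarrow> f s = 0"
    "\<And>u. u \<in> V - S \<Longrightarrow> lap (Restr E (V - S)) f u = 0 * f u"
    using lap_eigenfunction_cases[OF eig c] \<open>card S < card V\<close> by auto
  have u': "u \<in> V - S" using u f(1) by auto
  have "f v = f w" if "(v, w) \<in> Restr E (V - S)" for v w
    using lap_eigenvalue_nonneg(2)[OF induced_subgraph f(2) u' u(2)] that by simp
  \<comment> \<open>A nonzero constant on \<open>V - S\<close> would contradict the vanishing of the
    sum of \<open>f\<close>.\<close>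
  moreover have "\<exists>v\<in>V-S. f u \<noteq> f v"
  proof (rule ccontr)
    assume "\<not> ?thesis"
    hence "(\<Sum>v\<in>V-S. f v) = (\<Sum>v\<in>V-S. f u)" by (intro sum.cong) auto
    hence "(\<Sum>v\<in>V-S. f v) = card (V - S) * f u" by simp
    moreover have "(\<Sum>v\<in>V. f v) = (\<Sum>v\<in>V-S. f v)"
      using finite_V S_subset f(1) by (intro sum.mono_neutral_right) auto
    ultimately have "card (V - S) = 0"
      using lap_eigenfunction_sum_zero[OF eig c] u(2) by simp
    thus False using u' finite_V by (auto simp: card_eq_0_iff)
  qed
  ultimately show ?R using u' by (intro exI[of _ f]) blast
next
  assume ?R
  then obtain g :: "'a \<Rightarrow> real" and u v where uv: "u \<in> V - S" "v \<in> V - S" "g u \<noteq> g v"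
    and g: "\<And>u v. (u, v) \<in> Restr E (V - S) \<Longrightarrow> g u = g v" by blast
  \<comment> \<open>The mean of \<open>g\<close>: subtracting it makes the sum of \<open>f\<close>
    vanish, as the eigenvalue equation on \<open>S\<close> requires.\<close>
  define a where "a = (\<Sum>v\<in>V-S. g v) / card (V - S)"
  define f where "f = (\<lambda>v. if v \<in> V - S then g v - a else 0)"
  have "card (V - S) > 0" using uv finite_V by (auto simp: card_gt_0_iff)
  hence "(\<Sum>v\<in>V-S. g v - a) = 0" by (simp add: sum_subtractf a_def)
  hence sum_0: "(\<Sum>v\<in>V. f v) = 0"
    unfolding f_def using finite_V by (subst sum.inter_restrict[symmetric]) (auto simp: Int_absorb1)
  have "lap E f w = real (card S) * f w" if "w \<in> V" for w
  proof (cases "w \<in> S")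
    case True
    thus ?thesis using lap_dominating[OF True, of f] sum_0 by (simp add: f_def)
  next
    case False
    hence w: "w \<in> V - S" using that by blast
    have "f w = f x" if "(w, x) \<in> Restr E (V - S)" for x
      using g[OF that] that by (simp add: f_def)
    hence "lap (Restr E (V - S)) f w = 0" unfolding lap_def by (intro sum.neutral) auto
    thus ?thesis using lap_not_dominating[OF w, of f] by (simp add: f_def)
  qed
  moreover have "f u \<noteq> 0 \<or> f v \<noteq> 0" using uv by (auto simp: f_def)
  ultimately show ?L using uv by (intro exI[of _ f]) blast
qed

end

section \<open>Laplacian matrices\<close>

lemma nth_vertex_list_bij:
  assumes "finite (pverts \<Gamma>)"
  shows "bij_betw (\<lambda>i. vertex_list \<Gamma> ! i) {..<card (pverts \<Gamma>)} (pverts \<Gamma>)"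
  using assms by (intro bij_betw_nth) (auto simp: vertex_list_def)

lemma out_degree_with_proj: "out_degree (with_proj \<Gamma>) u = card (parcs \<Gamma> `` {u})"
  unfolding out_degree_def out_arcs_def
  by (rule bij_betw_same_card[of snd]) (auto simp: bij_betw_def inj_on_def image_iff)

lemma laplacian_matrix_carrier: "laplacian_matrix \<Gamma> \<in> carrier_mat (card (pverts \<Gamma>)) (card (pverts \<Gamma>))"
  unfolding laplacian_matrix_def degree_matrix_def adjacency_matrix_def by (intro minus_carrier_mat mat_carrier)

text \<open>A vector is a vertex function read along \<open>vertex_list\<close>. The embedding
  \<open>of_real\<close> lets the same result serve real and complex functions.\<close>

lemma laplacian_matrix_mult_vec:
  fixes f :: "'a::linorder \<Rightarrow> 'b::real_field"
  assumes fin: "finite (pverts \<Gamma>)" and sub: "parcs \<Gamma> \<subseteq> pverts \<Gamma> \<times> pverts \<Gamma>"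
  defines "N \<equiv> card (pverts \<Gamma>)"
  shows "map_mat of_real (laplacian_matrix \<Gamma>) *\<^sub>v vec N (\<lambda>i. f (vertex_list \<Gamma> ! i)) =
    vec N (\<lambda>i. lap (parcs \<Gamma>) f (vertex_list \<Gamma> ! i))"
proof (rule eq_vecI)
  fix i assume "i < dim_vec (vec N (\<lambda>i. lap (parcs \<Gamma>) f (vertex_list \<Gamma> ! i)))"
  hence i: "i < N" by simp
  let ?v = "\<lambda>i. vertex_list \<Gamma> ! i" and ?E = "parcs \<Gamma>" and ?V = "pverts \<Gamma>"
  have finE: "finite (?E `` {?v i})" using fin sub by (rule finite_Image_subset)
  have "(map_mat of_real (laplacian_matrix \<Gamma>) *\<^sub>v vec N (\<lambda>i. f (?v i))) $ i =
      (\<Sum>j<N. of_real (laplacian_matrix \<Gamma> $$ (i, j)) * f (?v j))"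
    using i laplacian_matrix_carrier[of \<Gamma>] by (auto simp: scalar_prod_def N_def atLeast0LessThan)
  also have "\<dots> = (\<Sum>j<N. (if j = i then of_nat (card (?E `` {?v i})) * f (?v i) else 0) -
      (if (?v i, ?v j) \<in> ?E then f (?v j) else 0))"
    using i by (intro sum.cong)
      (auto simp: laplacian_matrix_def degree_matrix_def adjacency_matrix_def N_def
        out_degree_with_proj algebra_simps)
  also have "\<dots> = of_nat (card (?E `` {?v i})) * f (?v i) - (\<Sum>j<N. if (?v i, ?v j) \<in> ?E then f (?v j) else 0)"
    using i by (simp add: sum_subtractf)
  \<comment> \<open>From here the sum runs over vertices instead of indices, and then only over
    neighbours.\<close>
  also have "(\<Sum>j<N. if (?v i, ?v j) \<in> ?E then f (?v j) else 0) = (\<Sum>v\<in>?V. if (?v i, v) \<in> ?E then f v else 0)"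
    using sum.reindex_bij_betw[OF nth_vertex_list_bij[OF fin]] by (simp add: N_def)
  also have "\<dots> = (\<Sum>v\<in>?E `` {?v i}. f v)"
    using fin sub by (intro sum.mono_neutral_cong_right) auto
  also have "of_nat (card (?E `` {?v i})) * f (?v i) - (\<Sum>v\<in>?E `` {?v i}. f v) = lap ?E f (?v i)"
    using finE by (simp add: lap_def sum_subtractf)
  finally show "(map_mat of_real (laplacian_matrix \<Gamma>) *\<^sub>v vec N (\<lambda>i. f (?v i))) $ i =
      vec N (\<lambda>i. lap ?E f (?v i)) $ i" using i by simp
qed (use laplacian_matrix_carrier[of \<Gamma>] in \<open>simp add: N_def\<close>)

lemma vec_of_vertex_function:
  assumes "finite (pverts \<Gamma>)" "w \<in> carrier_vec (card (pverts \<Gamma>))"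
  obtains f where "w = vec (card (pverts \<Gamma>)) (\<lambda>i. f (vertex_list \<Gamma> ! i))"
proof
  let ?g = "the_inv_into {..<card (pverts \<Gamma>)} (\<lambda>i. vertex_list \<Gamma> ! i)"
  have "?g (vertex_list \<Gamma> ! i) = i" if "i < card (pverts \<Gamma>)" for i
    using nth_vertex_list_bij[OF assms(1)] that by (intro the_inv_into_f_f) (auto simp: bij_betw_def)
  thus "w = vec (card (pverts \<Gamma>)) (\<lambda>i. (\<lambda>u. w $ ?g u) (vertex_list \<Gamma> ! i))"
    using assms(2) by (intro eq_vecI) auto
qed

lemma vec_vertex_function_eq_iff:
  assumes "finite (pverts \<Gamma>)"
  shows "vec (card (pverts \<Gamma>)) (\<lambda>i. f (vertex_list \<Gamma> ! i)) = vec (card (pverts \<Gamma>)) (\<lambda>i. g (vertex_list \<Gamma> ! i))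
    \<longleftrightarrow> (\<forall>u\<in>pverts \<Gamma>. f u = g u)"
proof -
  have "pverts \<Gamma> = (\<lambda>i. vertex_list \<Gamma> ! i) ` {..<card (pverts \<Gamma>)}"
    using nth_vertex_list_bij[OF assms] by (simp add: bij_betw_def)
  hence "(\<forall>u\<in>pverts \<Gamma>. f u = g u) \<longleftrightarrow> (\<forall>i<card (pverts \<Gamma>). f (vertex_list \<Gamma> ! i) = g (vertex_list \<Gamma> ! i))"
    by (metis (no_types, lifting) image_iff lessThan_iff)
  thus ?thesis by (auto simp: vec_eq_iff)
qed

lemma eigenvalue_laplacian_matrix_iff:
  fixes \<mu> :: "'b::real_field"
  assumes fin: "finite (pverts \<Gamma>)" and sub: "parcs \<Gamma> \<subseteq> pverts \<Gamma> \<times> pverts \<Gamma>"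
  shows "eigenvalue (map_mat of_real (laplacian_matrix \<Gamma>)) \<mu> \<longleftrightarrow>
    (\<exists>f. (\<exists>u\<in>pverts \<Gamma>. f u \<noteq> 0) \<and> (\<forall>u\<in>pverts \<Gamma>. lap (parcs \<Gamma>) f u = \<mu> * f u))"
proof -
  let ?N = "card (pverts \<Gamma>)" and ?w = "\<lambda>f. vec (card (pverts \<Gamma>)) (\<lambda>i. f (vertex_list \<Gamma> ! i))"
  have 0: "0\<^sub>v ?N = ?w (\<lambda>_. 0 :: 'b)" by auto
  have *: "eigenvector (map_mat of_real (laplacian_matrix \<Gamma>)) (?w f) \<mu> \<longleftrightarrow>
      (\<exists>u\<in>pverts \<Gamma>. f u \<noteq> 0) \<and> (\<forall>u\<in>pverts \<Gamma>. lap (parcs \<Gamma>) f u = \<mu> * f u)" for f :: "'a \<Rightarrow> 'b"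
  proof -
    have "\<mu> \<cdot>\<^sub>v ?w f = ?w (\<lambda>u. \<mu> * f u)" by auto
    thus ?thesis
      using laplacian_matrix_carrier[of \<Gamma>]
      by (simp add: eigenvector_def laplacian_matrix_mult_vec[OF fin sub] 0 vec_vertex_function_eq_iff[OF fin]
          vec_vertex_function_eq_iff[OF fin, of _ "\<lambda>_. 0"] vec_vertex_function_eq_iff[OF fin, of _ "\<lambda>u. \<mu> * f u"])
  qed
  show ?thesis
  proof
    assume "eigenvalue (map_mat of_real (laplacian_matrix \<Gamma>)) \<mu>"
    then obtain w where w: "eigenvector (map_mat of_real (laplacian_matrix \<Gamma>)) w \<mu>"
      by (auto simp: eigenvalue_def)
    hence "w \<in> carrier_vec ?N" using laplacian_matrix_carrier[of \<Gamma>] by (simp add: eigenvector_def)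
    then obtain f where "w = ?w f" using vec_of_vertex_function[OF fin] by blast
    thus "\<exists>f. (\<exists>u\<in>pverts \<Gamma>. f u \<noteq> 0) \<and> (\<forall>u\<in>pverts \<Gamma>. lap (parcs \<Gamma>) f u = \<mu> * f u)"
      using * w by blast
  qed (use * in \<open>auto simp: eigenvalue_def\<close>)
qed

lemma map_mat_of_real_real: "map_mat of_real A = (A :: real mat)"
  by (rule eq_matI) auto

text \<open>All nonzero eigenvalues are at least \<open>card S\<close> and 0 is a simple root of the
  characteristic polynomial, so \<open>second_smallest_eq_iff\<close> applies.\<close>

lemma algebraic_connectivity_dominated:
  fixes \<Gamma> :: "'a::linorder pair_pre_digraph"
  assumes "dominated_graph (pverts \<Gamma>) S (parcs \<Gamma>)" and N: "card (pverts \<Gamma>) \<ge> 2"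
  shows "algebraic_connectivity \<Gamma> = card S \<longleftrightarrow>
    (\<exists>f. (\<exists>u\<in>pverts \<Gamma>. f u \<noteq> 0) \<and> (\<forall>u\<in>pverts \<Gamma>. lap (parcs \<Gamma>) f u = real (card S) * f u))"
proof -
  interpret dominated_graph "pverts \<Gamma>" S "parcs \<Gamma>" by fact
  let ?N = "card (pverts \<Gamma>)" and ?L = "laplacian_matrix \<Gamma>"
  note L = laplacian_matrix_carrier[of \<Gamma>]
  note eigenvalue_iff = eigenvalue_laplacian_matrix_iff[OF finite_V E_subset]
  have eigenvalue_iff_real: "eigenvalue ?L \<mu> \<longleftrightarrow>
      (\<exists>f. (\<exists>u\<in>pverts \<Gamma>. f u \<noteq> 0) \<and> (\<forall>u\<in>pverts \<Gamma>. lap (parcs \<Gamma>) f u = \<mu> * f u))" for \<mu>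
    using eigenvalue_iff[of \<mu>] by (simp only: map_mat_of_real_real)
  have mult_vec: "?L *\<^sub>v vec ?N (\<lambda>i. f (vertex_list \<Gamma> ! i)) =
      vec ?N (\<lambda>i. lap (parcs \<Gamma>) f (vertex_list \<Gamma> ! i))" for f
    using laplacian_matrix_mult_vec[OF finite_V E_subset, of f] by (simp only: map_mat_of_real_real)
  have "\<mu> \<in> \<real>" if "eigenvalue (map_mat of_real ?L) \<mu>" for \<mu> :: complex
    using that lap_eigenvalue_real[OF finite_V E_subset sym_E] unfolding eigenvalue_iff by blast
  then obtain es where cp: "char_poly ?L = (\<Prod>e\<leftarrow>es. [:-e, 1:])" and len: "length es = ?N"
    using char_poly_splits_real[OF L] by blast
  have proots: "proots (char_poly ?L) = mset es"
    unfolding cp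
  proof (induction es)
    case (Cons a es)
    have "(\<Prod>e\<leftarrow>es. [:-e, 1:]) \<noteq> (0 :: real poly)" by (auto simp: prod_list_zero_iff)
    hence "proots ([:-a, 1:] * (\<Prod>e\<leftarrow>es. [:-e, 1:])) = {#a#} + proots (\<Prod>e\<leftarrow>es. [:-e, 1:])"
      by (subst proots_mult) auto
    thus ?case using Cons.IH by simp
  qed simp
  have es_iff: "e \<in> set es \<longleftrightarrow> eigenvalue ?L e" for e
    unfolding eigenvalue_root_char_poly[OF L] cp by (simp add: poly_prod_list prod_list_zero_iff image_iff)
  have "pverts \<Gamma> \<noteq> {}" using N by auto
  hence "0 \<in># mset es"
    unfolding set_mset_mset es_iff eigenvalue_iff_real
    by (intro exI[of _ "\<lambda>_. 1"]) (auto simp: lap_def)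
  \<comment> \<open>The multiplicity here is algebraic, so a generalized eigenvector
    \<open>y\<close> must be excluded too, not only a second kernel vector.\<close>
  moreover have "\<not> {#0, 0#} \<subseteq># mset es"
  proof
    assume "{#0, 0#} \<subseteq># mset es"
    then obtain M where "mset es = add_mset 0 (add_mset 0 M)"
      by (auto simp: subset_mset.le_iff_add)
    moreover obtain es' where "mset es' = M" using ex_mset by blast
    ultimately have "mset es = mset (0 # 0 # es')" by simp
    \<comment> \<open>Reordering the factors puts both zeros in front, as the Schur form argument
      requires.\<close>
    hence "mset (map (\<lambda>e. [:-e, 1:]) es) = mset (map (\<lambda>e. [:-e, 1:]) (0 # 0 # es'))" by (metis mset_map)
    hence "char_poly ?L = (\<Prod>e\<leftarrow>0 # 0 # es'. [:-e, 1:])"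
      unfolding cp by (metis prod_mset_prod_list)
    then obtain x y b where xy: "x \<in> carrier_vec ?N" "y \<in> carrier_vec ?N" "x \<noteq> 0\<^sub>v ?N" "\<And>c. y \<noteq> c \<cdot>\<^sub>v x"
      and eqs: "?L *\<^sub>v x = 0 \<cdot>\<^sub>v x" "?L *\<^sub>v y = 0 \<cdot>\<^sub>v y + b \<cdot>\<^sub>v x"
      using repeated_eigenvalue_generalized_eigenvector[OF L] by metis
    let ?w = "\<lambda>f. vec ?N (\<lambda>i. f (vertex_list \<Gamma> ! i)) :: real vec"
    obtain f g where fg: "x = ?w f" "y = ?w g"
      using vec_of_vertex_function[OF finite_V] xy(1,2) by metis
    note w_eq_iff = vec_vertex_function_eq_iff[OF finite_V]
    have smult: "c \<cdot>\<^sub>v ?w h = ?w (\<lambda>u. c * h u)" for c h by auto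
    have add: "?w h + ?w k = ?w (\<lambda>u. h u + k u)" for h k by auto
    have "lap (parcs \<Gamma>) f u = 0" if "u \<in> pverts \<Gamma>" for u
      using eqs(1) that unfolding fg mult_vec smult w_eq_iff[of "lap (parcs \<Gamma>) f" "\<lambda>u. 0 * f u"] by simp
    then obtain c where c: "\<And>u. u \<in> pverts \<Gamma> \<Longrightarrow> f u = c" using lap_kernel_constant by blast
    have "?w f \<noteq> ?w (\<lambda>_. 0)" using xy(3) unfolding fg by (simp add: zero_vec_def)
    hence "c \<noteq> 0" using c by (auto simp: w_eq_iff[of f "\<lambda>_. 0"])
    have lap_g: "lap (parcs \<Gamma>) g u = b * c" if "u \<in> pverts \<Gamma>" for u
      using eqs(2) that c
      unfolding fg mult_vec smult add[of "\<lambda>u. 0 * g u" "\<lambda>u. b * f u"] w_eq_iff[of "lap (parcs \<Gamma>) g" "\<lambda>u. 0 * g u + b * f u"] by simp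
    \<comment> \<open>The Laplacian of \<open>g\<close> has the constant value \<open>b * c\<close>,
      yet its values sum to 0. So \<open>g\<close> lies in the kernel and is constant, like
      \<open>f\<close>.\<close>
    have "b * c = 0"
      using sum_lap_eq_0[OF finite_V E_subset sym_E, of g] lap_g N by simp
    then obtain d where d: "\<And>u. u \<in> pverts \<Gamma> \<Longrightarrow> g u = d"
      using lap_kernel_constant[of g] lap_g by auto
    have "y = (d / c) \<cdot>\<^sub>v x"
      unfolding fg smult w_eq_iff[of g "\<lambda>u. d / c * f u"] using c d \<open>c \<noteq> 0\<close> by simp
    thus False using xy(4) by blast
  qed
  moreover have "real (card S) > 0" using finite_S S_nonempty by (simp add: card_gt_0_iff)
  moreover have "real (card S) \<le> e" if "e \<in># mset es" "e \<noteq> 0" for e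
    using that lap_eigenvalue_ge unfolding set_mset_mset es_iff eigenvalue_iff_real by blast
  ultimately have "rev (sorted_list_of_multiset (mset es)) ! (size (mset es) - 2) = card S \<longleftrightarrow> real (card S) \<in># mset es"
    using N len by (intro second_smallest_eq_iff) auto
  \<comment> \<open>Indexing from 1 turns eigenvalue number
    \<open>card (pverts \<Gamma>) - 1\<close> into list position
    \<open>card (pverts \<Gamma>) - 2\<close>.\<close>
  thus ?thesis
    unfolding algebraic_connectivity_def laplacian_eigenvalue_def laplacian_eigenvalues_def proots
    using len by (simp add: es_iff eigenvalue_iff_real numeral_2_eq_2)
qed

section \<open>Power graphs of cyclic groups\<close>

lemma power_graph_integer_mod_group_adj:
  assumes "n > 0"
  shows "(u, v) \<in> parcs (power_graph (integer_mod_group n)) \<longleftrightarrow>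
    u \<in> {0..<int n} \<and> v \<in> {0..<int n} \<and> u \<noteq> v \<and>
    ((\<exists>k::nat. k > 0 \<and> v = (int k * u) mod int n) \<or> (\<exists>k::nat. k > 0 \<and> u = (int k * v) mod int n))"
  using assms by (simp add: power_graph_def carrier_integer_mod_group)

definition dominating_residues :: "nat \<Rightarrow> int set" where
  "dominating_residues n = insert 0 {u \<in> {0<..<int n}. coprime u (int n)}"

text \<open>Totatives may a priori reach \<open>n\<close>, but \<open>n > 1\<close> is not coprime
  to itself, so they are exactly the coprime residues; 0 is not among them.\<close>

lemma card_dominating_residues:
  assumes "n > 1"
  shows "card (dominating_residues n) = totient n + 1"
proof -
  have "{u \<in> {0<..<int n}. coprime u (int n)} = int ` totatives n"
  proof (intro equalityI subsetI)
    fix u assume u: "u \<in> {u \<in> {0<..<int n}. coprime u (int n)}"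
    hence "nat u \<in> totatives n" by (auto simp: in_totatives_iff coprime_int_iff[symmetric])
    thus "u \<in> int ` totatives n" using u by (intro image_eqI[of _ _ "nat u"]) auto
  qed (use assms totatives_less in \<open>auto simp: in_totatives_iff\<close>)
  hence "dominating_residues n = insert 0 (int ` totatives n)" by (simp only: dominating_residues_def)
  thus ?thesis by (auto simp: totient_def card_image card_insert_if)
qed

text \<open>The residue \<open>u\<close> has an inverse \<open>x\<close> modulo \<open>n\<close>,
  and \<open>x * v\<close> is the required multiplier.\<close>

lemma multiple_of_coprime_residue:
  assumes "n > 0" "coprime u (int n)" "v \<in> {0..<int n}"
  shows "\<exists>k::nat. k > 0 \<and> v = (int k * u) mod int n"
proof -
  obtain x where x: "[u * x = 1] (mod int n)" using assms(2) cong_solve_coprime_int by blast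
  \<comment> \<open>Adding \<open>int n\<close> keeps the residue class and makes the multiplier
    positive even when \<open>x * v\<close> reduces to 0.\<close>
  define k where "k = (x * v) mod int n + int n"
  have "[k * u = (x * v) * u] (mod int n)"
    unfolding k_def by (intro cong_mult cong_refl) (simp add: cong_def)
  also have "(x * v) * u = (u * x) * v" by (simp add: mult_ac)
  also have "[(u * x) * v = 1 * v] (mod int n)" using x by (intro cong_mult cong_refl)
  finally have "v = (k * u) mod int n" using assms(3) by (simp add: cong_def)
  moreover have "k > 0" using assms(1) by (simp add: k_def add_nonneg_pos)
  ultimately show ?thesis by (intro exI[of _ "nat k"]) simp
qed

text \<open>The residue 0 is the \<open>n\<close>-th multiple of every vertex, and every vertex is a
  positive multiple of each coprime residue.\<close>

lemma dominated_power_graph: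
  assumes n: "n > 1"
  defines "\<Gamma> \<equiv> power_graph (integer_mod_group n)"
  shows "dominated_graph (pverts \<Gamma>) (dominating_residues n) (parcs \<Gamma>)"
proof
  have V: "pverts \<Gamma> = {0..<int n}" using n by (simp add: \<Gamma>_def power_graph_def carrier_integer_mod_group)
  note adj = power_graph_integer_mod_group_adj[of n, folded \<Gamma>_def]
  show "finite (pverts \<Gamma>)" by (simp add: V)
  show "parcs \<Gamma> \<subseteq> pverts \<Gamma> \<times> pverts \<Gamma>" "sym (parcs \<Gamma>)" "irrefl (parcs \<Gamma>)"
    using n by (auto simp: V adj sym_def irrefl_def)
  show "dominating_residues n \<subseteq> pverts \<Gamma>" "dominating_residues n \<noteq> {}"
    using n by (auto simp: V dominating_residues_def)
  fix s v assume sv: "s \<in> dominating_residues n" "v \<in> pverts \<Gamma>" "s \<noteq> v"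
  show "(s, v) \<in> parcs \<Gamma>"
  proof (cases "s = 0")
    case True
    have "\<exists>k>0. 0 = int k * v mod int n" using n by (intro exI[of _ n]) simp
    thus ?thesis using sv n True by (auto simp: adj V)
  next
    case False
    hence "\<exists>k::nat. k > 0 \<and> v = (int k * s) mod int n"
      using sv n by (intro multiple_of_coprime_residue) (auto simp: V dominating_residues_def)
    thus ?thesis using sv n by (auto simp: adj V dominating_residues_def)
  qed
qed

section \<open>Connectedness of the graph induced on the nonzero non-generators\<close>

theorem theorem3p3:
  fixes n :: nat
  assumes "n > 1"
  shows "algebraic_connectivity (power_graph (integer_mod_group n)) = real (totient n) + 1 \<longleftrightarrow>
    prime n \<or> (\<exists>p q :: nat. prime p \<and> prime q \<and> p \<noteq> q \<and> n = p * q)"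
proof -
  define \<Gamma> where "\<Gamma> = power_graph (integer_mod_group n)"
  define V where "V = {0..<int n}"
  define S where "S = dominating_residues n"
  define E where "E = parcs \<Gamma>"
  have V_eq: "pverts \<Gamma> = V" using assms by (simp add: \<Gamma>_def V_def power_graph_def carrier_integer_mod_group)
  interpret dominated_graph V S E
    using dominated_power_graph[OF assms] by (simp add: \<Gamma>_def[symmetric] V_eq S_def E_def)
  have adj: "(u, v) \<in> E \<longleftrightarrow> u \<in> V \<and> v \<in> V \<and> u \<noteq> v \<and>
    ((\<exists>k::nat. k > 0 \<and> v = (int k * u) mod int n) \<or> (\<exists>k::nat. k > 0 \<and> u = (int k * v) mod int n))" for u v
    using power_graph_integer_mod_group_adj[of n] assms unfolding E_def \<Gamma>_def V_def by simp
  define H where "H = V - S"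
  have H_iff: "u \<in> H \<longleftrightarrow> u \<in> V \<and> u \<noteq> 0 \<and> \<not> coprime u (int n)" for u
    by (auto simp: H_def S_def V_def dominating_residues_def)
  have "algebraic_connectivity \<Gamma> = card S \<longleftrightarrow>
      (\<exists>f. (\<exists>u\<in>V. f u \<noteq> 0) \<and> (\<forall>u\<in>V. lap E f u = real (card S) * f u))" (is "_ \<longleftrightarrow> ?eig")
    using algebraic_connectivity_dominated[of \<Gamma> S] dominated_graph_axioms assms
    by (simp add: V_eq E_def[symmetric]) (simp add: V_def)
  moreover have "real (card S) = real (totient n) + 1"
    using card_dominating_residues[OF assms] by (simp add: S_def)
  ultimately have alg: "algebraic_connectivity \<Gamma> = real (totient n) + 1 \<longleftrightarrow> ?eig" by simp
  show ?thesis
  proof (cases "prime n")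
    case True
    have "u \<in> S" if "u \<in> V" for u
    proof (cases "u = 0")
      case False
      hence "\<not> int n dvd u" using that by (simp add: V_def zdvd_not_zless)
      hence "coprime u (int n)" using True prime_imp_coprime[of "int n" u] by (simp add: coprime_commute)
      thus ?thesis using H_iff[of u] that unfolding H_def by blast
    qed (simp add: S_def dominating_residues_def)
    hence "S = V" using S_subset by blast
    define f where "f = (\<lambda>u::int. if u = 0 then 1 else if u = 1 then -1 else 0 :: real)"
    have "(\<Sum>v\<in>V. f v) = (\<Sum>v\<in>{0, 1}. f v)"
      using assms by (intro sum.mono_neutral_right) (auto simp: V_def f_def)
    hence "(\<Sum>v\<in>V. f v) = 0" by (simp add: f_def)
    hence "\<forall>u\<in>V. lap E f u = real (card S) * f u"
      using lap_dominating[of _ f] \<open>S = V\<close> by simp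
    moreover have "0 \<in> V" "f 0 \<noteq> 0" using assms by (auto simp: V_def f_def)
    ultimately have ?eig by blast
    thus ?thesis using alg True by (simp add: \<Gamma>_def)
  next
    case False
    \<comment> \<open>As \<open>n\<close> is not prime, a prime divisor is a proper one: a nonzero
      residue sharing the factor \<open>p\<close> with \<open>n\<close>.\<close>
    have prime_in: "int p \<in> H" if "prime p" "p dvd n" for p
    proof -
      have "p \<noteq> n" using that(1) False by blast
      hence "p < n" using dvd_imp_le[OF that(2)] assms by simp
      moreover have "\<not> coprime (int p) (int n)"
        using that by (auto simp: coprime_int_iff coprime_absorb_left)
      ultimately show ?thesis using that by (auto simp: H_iff V_def)
    qed
    have prime_factor: "\<exists>p. prime p \<and> p dvd n \<and> int p dvd u" if u: "u \<in> H" for u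
    proof -
      obtain m where m: "u = int m" using u by (auto simp: H_iff V_def elim: nonneg_int_cases)
      have "\<not> coprime m n" using u unfolding H_iff m coprime_int_iff by blast
      hence "gcd m n \<noteq> 1" by (simp only: coprime_iff_gcd_eq_1 not_False_eq_True)
      then obtain p where "prime p" "p dvd gcd m n" using prime_factor_nat by blast
      thus ?thesis using m by (intro exI[of _ p]) simp
    qed
    have "S \<noteq> V" using prime_in assms prime_factor_nat[of n] unfolding H_def by auto
    have "?eig \<longleftrightarrow> (\<exists>p q. prime p \<and> prime q \<and> p \<noteq> q \<and> n = p * q)" (is "_ \<longleftrightarrow> ?pq")
      unfolding lap_eigenvalue_card_dominating_iff[OF \<open>S \<noteq> V\<close>] H_def[symmetric]
    proof
      assume ?pq
      then obtain p q where pq: "prime p" "prime q" "p \<noteq> q" "n = p * q" by blast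
      \<comment> \<open>The indicator of the multiples of \<open>p\<close> separates them from the
        multiples of \<open>q\<close>; these two classes partition \<open>H\<close>.\<close>
      define g where "g = (\<lambda>u. if int p dvd u then 1 else 0 :: real)"
      have not_both: "\<not> (int p dvd u \<and> int q dvd u)" if "u \<in> H" for u
      proof
        assume "int p dvd u \<and> int q dvd u"
        moreover have "coprime (int p) (int q)" using pq primes_coprime by auto
        ultimately have "int n dvd u" using pq(4) by (simp add: divides_mult)
        thus False using that by (auto simp: H_iff V_def zdvd_not_zless)
      qed
      have one: "int p dvd u \<or> int q dvd u" if "u \<in> H" for u
        using prime_factor[OF that] pq by (metis prime_dvd_mult_iff primes_dvd_imp_eq)
      \<comment> \<open>Divisors of \<open>n\<close> survive the reduction modulo \<open>n\<close>,
        so adjacency transfers divisibility by \<open>p\<close> and by \<open>q\<close> in one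
        common direction.\<close>
      have dvd_mono: "r dvd v" if "r dvd int n" "r dvd u" "v = int k * u mod int n" for r u v :: int and k
        using that by (simp add: dvd_mod)
      have "g u = g v" if "(u, v) \<in> Restr E H" for u v
      proof -
        have u: "u \<in> H" and v: "v \<in> H" and "(u, v) \<in> E" using that by auto
        hence "(\<forall>r. r dvd int n \<longrightarrow> r dvd u \<longrightarrow> r dvd v) \<or> (\<forall>r. r dvd int n \<longrightarrow> r dvd v \<longrightarrow> r dvd u)"
          unfolding adj using dvd_mono by blast
        moreover have "int p dvd int n" "int q dvd int n" using pq by auto
        \<comment> \<open>One direction suffices, since each vertex of \<open>H\<close> is divisible
          by exactly one of \<open>p\<close> and \<open>q\<close>.\<close>
        ultimately have "int p dvd u \<longleftrightarrow> int p dvd v" using not_both one u v by blast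
        thus ?thesis by (simp add: g_def)
      qed
      moreover have "int p \<in> H" "int q \<in> H" using prime_in pq by auto
      moreover have "g (int p) \<noteq> g (int q)" using pq primes_dvd_imp_eq[of p q] by (auto simp: g_def)
      ultimately show "\<exists>g :: int \<Rightarrow> real. (\<exists>u\<in>H. \<exists>v\<in>H. g u \<noteq> g v) \<and> (\<forall>(u, v)\<in>Restr E H. g u = g v)"
        by (intro exI[of _ g]) blast
    next
      assume "\<exists>g :: int \<Rightarrow> real. (\<exists>u\<in>H. \<exists>v\<in>H. g u \<noteq> g v) \<and> (\<forall>(u, v)\<in>Restr E H. g u = g v)"
      then obtain g :: "int \<Rightarrow> real" and u v where uv: "u \<in> H" "v \<in> H" "g u \<noteq> g v"
        and g: "\<And>u v. (u, v) \<in> Restr E H \<Longrightarrow> g u = g v" by blast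
      \<comment> \<open>Divisibility between integers in \<open>H\<close> gives adjacency: the
        quotient is a positive multiplier, and reduction leaves \<open>v < int n\<close>
        unchanged.\<close>
      have g_dvd: "g u = g v" if uv: "u \<in> H" "v \<in> H" and "u dvd v" for u v
      proof (cases "u = v")
        case False
        have "u > 0" "v > 0" "v < int n" using uv by (auto simp: H_iff V_def)
        obtain k where k: "v = u * k" using \<open>u dvd v\<close> by blast
        hence "k > 0" using \<open>u > 0\<close> \<open>v > 0\<close> by (simp add: zero_less_mult_iff)
        hence "nat k > 0 \<and> v = (int (nat k) * u) mod int n" using k \<open>v > 0\<close> \<open>v < int n\<close> by (simp add: mult.commute)
        hence "(u, v) \<in> E" using uv False unfolding adj H_iff by blast
        thus ?thesis using g uv by blast
      qed simp
      obtain p q where p: "prime p" "p dvd n" "int p dvd u" and q: "prime q" "q dvd n" "int q dvd v"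
        using prime_factor uv by metis
      have gu: "g u = g (int p)" and gv: "g v = g (int q)"
        using g_dvd[OF prime_in[OF p(1,2)] uv(1) p(3)] g_dvd[OF prime_in[OF q(1,2)] uv(2) q(3)] by simp_all
      hence "p \<noteq> q" using uv by auto
      hence "p * q dvd n" using p q primes_coprime[of p q] by (intro divides_mult) auto
      have "n = p * q"
      proof (rule ccontr)
        assume "n \<noteq> p * q"
        \<comment> \<open>Then \<open>p * q\<close> lies in \<open>H\<close> and is a common
          neighbour of \<open>p\<close> and \<open>q\<close>, which forces
          \<open>g u = g v\<close>.\<close>
        hence "p * q < n" using dvd_imp_le[OF \<open>p * q dvd n\<close>] assms by simp
        moreover have "\<not> coprime (int (p * q)) (int n)"
          unfolding coprime_int_iff coprime_absorb_left[OF \<open>p * q dvd n\<close>] using p by auto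
        ultimately have "int (p * q) \<in> H" using p q by (auto simp: H_iff V_def dest: prime_gt_0_nat)
        hence "g (int p) = g (int (p * q))" "g (int q) = g (int (p * q))"
          using g_dvd[OF prime_in[OF p(1,2)]] g_dvd[OF prime_in[OF q(1,2)]] by simp_all
        thus False using gu gv uv by simp
      qed
      thus ?pq using p q \<open>p \<noteq> q\<close> by blast
    qed
    thus ?thesis using alg False by (simp add: \<Gamma>_def)
  qed
qed

end
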